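(* Let $\mathscr T=(V,E)$ be a rooted directed tree with root $\mathsf{root}$ and let $\mathscr T_\infty$ be the extended directed tree associated with $\mathscr T$, with vertex set $V_\infty=V\sqcup\{\infty\}$. Let $u\in V$, $b\in V_\infty$ and let $\lambda_u=\{\lambda_{uv}\}_{v\in V_\infty}$ be a weight system of complex numbers. Then the weighted join operator $W^{(b)}_{\lambda_u}$ on $\mathscr T$ is bounded (i.e. belongs to $B(\ell^2(V))$) if and only if $$\lambda_u\ \text{belongs to}\ \begin{cases}\ell^2(V)&\text{if } b=\infty,\\ \ell^\infty(V)&\text{if } b=u,\\ \ell^\infty(\mathsf{Des}(u))&\text{otherwise.}\end{cases}$$
   Context: Trees. A directed tree $\mathscr T=(V,E)$ is a directed graph (no loops, $V$ and $E$ nonempty) which has no circuits, is connected (ignoring orientation), and in which every non-root vertex $v$ has exactly one parent $\mathsf{par}(v)$ (the $p$ with $(p,v)\in E$); a root is a vertex with no parent, and $\mathscr T$ is rooted if it has a unique root $\mathsf{root}$. Throughout $\mathrm{card}(V)=\aleph_0$. $\mathsf{Des}(u)$ is the set of descendants of $u$, including $u$ (in $\ell^\infty(\mathsf{Des}(u))$ it is taken inside $V$, without $\infty$); $\mathsf{Asc}(u)=\{\mathsf{par}^{\langle n\rangle}(u):n\ge1\}$ is the set of strict ancestors. The depth $\mathsf d_u$ is the length of the directed path from $\mathsf{root}$ to $u$. Join operations. The extended tree $\mathscr T_\infty$ has vertex set $V_\infty=V\sqcup\{\infty\}$ and $\infty$ is declared a child (hence a descendant) of every $v\in V$; thus $\mathsf{Asc}(\infty)=V$.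 For $u,v\in V_\infty$: $u\sqcup v=u$ if $u\in\mathsf{Des}(v)$; $=v$ if $v\in\mathsf{Des}(u)$; $=\infty$ otherwise. For $u,v\in V$, $u\sqcap v$ is the vertex of largest depth among $\{w\in V:\mathsf{par}^{\langle n\rangle}(u)=w=\mathsf{par}^{\langle m\rangle}(v)\text{ for some }m,n\ge0\}$, and $\infty\sqcap u=u=u\sqcap\infty$. The join at the base point $b\in V_\infty$ is $u\sqcup_bv=u\sqcap v$ if $u,v\in\mathsf{Asc}(b)$; $=u$ if $v=b$; $=v$ if $u=b$; $=u\sqcup v$ otherwise. (So $\sqcup_\infty=\sqcap$.) Weighted join operator. A weight system is a family $\lambda_u=\{\lambda_{uv}\}_{v\in V_\infty}\subseteq\mathbb C$ with $\lambda_{u\infty}=0$. For $f:V\to\mathbb C$ put $(\Lambda^{(b)}_uf)(w)=\sum_{v\in V:\,u\sqcup_bv=w}\lambda_{uv}f(v)$, $w\in V$. Then $\mathscr D(W^{(b)}_{\lambda_u})=\{f\in\ell^2(V):\Lambda^{(b)}_uf\in\ell^2(V)\}$ (in particular the series defining $\Lambda^{(b)}_uf$ converge) and $W^{(b)}_{\lambda_u}f=\Lambda^{(b)}_uf$. *)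

theory Defs
  imports "HOL-Analysis.Analysis" "Graph_Theory.Graph_Theory"
begin

section \<open>Rooted directed trees\<close>

definition is_root :: "'a pair_pre_digraph \<Rightarrow> 'a \<Rightarrow> bool" where
  "is_root T v \<longleftrightarrow> v \<in> pverts T \<and> (\<nexists>p. (p, v) \<in> parcs T)"

text \<open>
  The library predicate \<^const>\<open>tree\<close> says: connected after forgetting the orientation of the
  arcs, and without (directed) cycles.
\<close>

locale rooted_directed_tree = pair_loopfree_digraph T for T :: "'a pair_pre_digraph" +
  assumes verts_countable: "countable (pverts T)"
    and verts_infinite: "infinite (pverts T)"
    and arcs_nonempty: "parcs T \<noteq> {}"
    and tree: "tree (with_proj T)"
    and unique_parent: "\<And>v. v \<in> pverts T \<Longrightarrow> \<not> is_root T v \<Longrightarrow> \<exists>!p. (p, v) \<in> parcs T"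
    and unique_root: "\<exists>!r. is_root T r"

definition tree_root :: "'a pair_pre_digraph \<Rightarrow> 'a" where
  "tree_root T = (THE r. is_root T r)"

text \<open>The parent is undefined (\<^const>\<open>None\<close>) at the root, and so are the iterates beyond the root.\<close>

definition par :: "'a pair_pre_digraph \<Rightarrow> 'a \<Rightarrow> 'a option" where
  "par T v = (if \<exists>p. (p, v) \<in> parcs T then Some (THE p. (p, v) \<in> parcs T) else None)"

primrec par_pow :: "'a pair_pre_digraph \<Rightarrow> nat \<Rightarrow> 'a \<Rightarrow> 'a option" where
  "par_pow T 0 v = Some v"
| "par_pow T (Suc n) v = Option.bind (par_pow T n v) (par T)"

definition Des :: "'a pair_pre_digraph \<Rightarrow> 'a \<Rightarrow> 'a set" where
  "Des G u = {v. u \<rightarrow>\<^sup>*\<^bsub>with_proj G\<^esub> v}"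

definition Asc :: "'a pair_pre_digraph \<Rightarrow> 'a \<Rightarrow> 'a set" where
  "Asc T u = {w. \<exists>n\<ge>1. par_pow T n u = Some w}"

definition depth :: "'a pair_pre_digraph \<Rightarrow> 'a \<Rightarrow> nat" where
  "depth T u = (THE n. \<exists>p. pre_digraph.apath (with_proj T) (tree_root T) p u \<and> length p = n)"


section \<open>The extended tree and the join operations\<close>

text \<open>
  A vertex \<open>v\<close> of the tree becomes \<open>Some v\<close> in the extended tree; the point at infinity is
  \<^const>\<open>None\<close>.
\<close>

definition extended_tree :: "'a pair_pre_digraph \<Rightarrow> 'a option pair_pre_digraph" where
  "extended_tree T =
     \<lparr> pverts = insert None (Some ` pverts T),
       parcs = {(Some p, Some v) | p v. (p, v) \<in> parcs T} \<union> {(Some v, None) | v. v \<in> pverts T} \<rparr>"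

text \<open>
  Ancestors in the extended tree. The point at infinity has every vertex of the tree as a parent,
  so its ancestors cannot be obtained by iterating \<^const>\<open>par\<close>.
\<close>

fun ext_Asc :: "'a pair_pre_digraph \<Rightarrow> 'a option \<Rightarrow> 'a option set" where
  "ext_Asc T None = Some ` pverts T"
| "ext_Asc T (Some u) = Some ` Asc T u"

definition join :: "'a pair_pre_digraph \<Rightarrow> 'a option \<Rightarrow> 'a option \<Rightarrow> 'a option" where
  "join T x y =
     (if x \<in> Des (extended_tree T) y then x
      else if y \<in> Des (extended_tree T) x then y
      else None)"

fun meet :: "'a pair_pre_digraph \<Rightarrow> 'a option \<Rightarrow> 'a option \<Rightarrow> 'a option" where
  "meet T None y = y"
| "meet T x None = x"
| "meet T (Some u) (Some v) =
     Some (arg_max (depth T)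
       (\<lambda>w. w \<in> pverts T \<and> (\<exists>n m. par_pow T n u = Some w \<and> par_pow T m v = Some w)))"

definition join_at :: "'a pair_pre_digraph \<Rightarrow> 'a option \<Rightarrow> 'a option \<Rightarrow> 'a option \<Rightarrow> 'a option" where
  "join_at T b x y =
     (if x \<in> ext_Asc T b \<and> y \<in> ext_Asc T b then meet T x y
      else if y = b then x
      else if x = b then y
      else join T x y)"


section \<open>Sequence spaces and operators\<close>

definition square_summable_on :: "('a \<Rightarrow> complex) \<Rightarrow> 'a set \<Rightarrow> bool" where
  "square_summable_on f A \<longleftrightarrow> (\<lambda>v. (cmod (f v))\<^sup>2) summable_on A"

text \<open>Functions on \<open>V\<close> are represented by their extension by zero to the whole type.\<close>

definition ell2 :: "'a set \<Rightarrow> ('a \<Rightarrow> complex) set" where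
  "ell2 V = {f. (\<forall>v. v \<notin> V \<longrightarrow> f v = 0) \<and> square_summable_on f V}"

definition ell2_norm :: "'a set \<Rightarrow> ('a \<Rightarrow> complex) \<Rightarrow> real" where
  "ell2_norm V f = sqrt (\<Sum>\<^sub>\<infinity>v\<in>V. (cmod (f v))\<^sup>2)"

text \<open>
  The operator with domain \<open>D\<close> and action \<open>A\<close> is an element of the algebra of bounded linear
  operators on \<open>ell2 V\<close>; in particular it is everywhere defined.
\<close>

definition bounded_operator_on_ell2 ::
    "'a set \<Rightarrow> ('a \<Rightarrow> complex) set \<Rightarrow> (('a \<Rightarrow> complex) \<Rightarrow> ('a \<Rightarrow> complex)) \<Rightarrow> bool" where
  "bounded_operator_on_ell2 V D A \<longleftrightarrow>
     D = ell2 V \<and>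
     (\<forall>f\<in>D. A f \<in> ell2 V) \<and>
     (\<forall>f\<in>D. \<forall>g\<in>D. A (\<lambda>v. f v + g v) = (\<lambda>w. A f w + A g w)) \<and>
     (\<forall>c. \<forall>f\<in>D. A (\<lambda>v. c * f v) = (\<lambda>w. c * A f w)) \<and>
     (\<exists>C. \<forall>f\<in>D. ell2_norm V (A f) \<le> C * ell2_norm V f)"


section \<open>Weighted join operators\<close>

text \<open>
  For the fixed vertex \<open>u\<close>, a weight system is a family \<open>lam\<close> indexed by the vertices of the
  extended tree; \<open>lam (Some v)\<close> is the weight at \<open>(u, v)\<close>. Values of \<open>lam\<close> at
  \<open>Some v\<close> with \<open>v\<close> outside the tree are never used.
\<close>

definition weight_system :: "('a option \<Rightarrow> complex) \<Rightarrow> bool" where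
  "weight_system lam \<longleftrightarrow> lam None = 0"

definition join_fibre :: "'a pair_pre_digraph \<Rightarrow> 'a option \<Rightarrow> 'a \<Rightarrow> 'a \<Rightarrow> 'a set" where
  "join_fibre T b u w = {v \<in> pverts T. join_at T b (Some u) (Some v) = Some w}"

definition wj_map ::
    "'a pair_pre_digraph \<Rightarrow> 'a option \<Rightarrow> 'a \<Rightarrow> ('a option \<Rightarrow> complex)
      \<Rightarrow> ('a \<Rightarrow> complex) \<Rightarrow> ('a \<Rightarrow> complex)" where
  "wj_map T b u lam f =
     (\<lambda>w. if w \<in> pverts T then \<Sum>\<^sub>\<infinity>v\<in>join_fibre T b u w. lam (Some v) * f v else 0)"

text \<open>
  Since \<^const>\<open>infsum\<close> is 0 for divergent series, convergence is required explicitly. The index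
  sets carry no order, so convergence is unconditional.
\<close>

definition wj_domain ::
    "'a pair_pre_digraph \<Rightarrow> 'a option \<Rightarrow> 'a \<Rightarrow> ('a option \<Rightarrow> complex) \<Rightarrow> ('a \<Rightarrow> complex) set" where
  "wj_domain T b u lam =
     {f \<in> ell2 (pverts T).
        (\<forall>w\<in>pverts T. (\<lambda>v. lam (Some v) * f v) summable_on join_fibre T b u w) \<and>
        wj_map T b u lam f \<in> ell2 (pverts T)}"

end

theory Submission
  imports Defs
begin

text \<open>
  The map \<open>v \<mapsto> u \<squnion>\<^sub>b v\<close> cuts \<open>V\<close> into fibres, one over each vertex \<open>w\<close> (and one over the point
  at infinity, which does not contribute). On the part of \<open>f\<close> carried by the fibre over \<open>w\<close> the
  operator is the rank-one map that pairs \<open>f\<close> with the conjugated weights and puts the result at \<open>w\<close>;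
  its norm is the \<open>\<ell>\<^sup>2\<close>-norm of the weights on that fibre. Fibres over different vertices are disjoint,
  so the operator is an orthogonal sum of these rank-one maps, and it is bounded exactly when the
  \<open>\<ell>\<^sup>2\<close>-norms of the weights on the fibres have a common bound. This is
  \<open>wj_bounded_iff_fibre_sums_bounded\<close>; it holds for any directed graph, since only the fibres enter.
  Sufficiency is the Cauchy-Schwarz inequality on each fibre, necessity comes from testing the operator
  on the conjugated weights restricted to a finite piece of a fibre.

  The tree then serves to find the fibres. The fact that matters is \<open>par_pow_reaches_root\<close>: the chain of
  parents of every vertex ends at the root, so a vertex has only finitely many ancestors.

  \<^item> If \<open>b = \<infinity>\<close>, then \<open>u \<sqinter> v\<close> is \<open>u\<close> or an ancestor of \<open>u\<close>. Finitely many fibres fill \<open>V\<close>, and a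
    common bound on them amounts to square-summability on \<open>V\<close>.
  \<^item> If \<open>b = u\<close>, then the join is \<open>v\<close>, every fibre is a single vertex and the operator is the
    multiplication by the weights.
  \<^item> If \<open>b\<close> is another vertex, then away from the finite set \<open>F\<close> that consists of \<open>b\<close>, \<open>u\<close> and their
    ancestors the join is \<open>v\<close> for a descendant \<open>v\<close> of \<open>u\<close>, and \<open>\<infinity>\<close> for the others. A fibre is
    therefore at most one descendant of \<open>u\<close> together with part of \<open>F\<close>. The finitely many weights
    on \<open>F\<close> cannot affect boundedness.

  The last two cases are both instances of \<open>wj_bounded_at_almost_identity\<close>.
\<close>


section \<open>Square-summable families\<close>

lemma square_summable_on_iff_bounded_sums:
  "square_summable_on f A \<longleftrightarrow>
     (\<exists>C. \<forall>S. finite S \<and> S \<subseteq> A \<longrightarrow> (\<Sum>v\<in>S. (cmod (f v))\<^sup>2) \<le> C)"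
proof
  assume f: "square_summable_on f A"
  have "(\<Sum>v\<in>S. (cmod (f v))\<^sup>2) \<le> (\<Sum>\<^sub>\<infinity>v\<in>A. (cmod (f v))\<^sup>2)" if "finite S" "S \<subseteq> A" for S
    using f that unfolding square_summable_on_def by (intro finite_sum_le_infsum) auto
  then show "\<exists>C. \<forall>S. finite S \<and> S \<subseteq> A \<longrightarrow> (\<Sum>v\<in>S. (cmod (f v))\<^sup>2) \<le> C"
    by blast
next
  assume "\<exists>C. \<forall>S. finite S \<and> S \<subseteq> A \<longrightarrow> (\<Sum>v\<in>S. (cmod (f v))\<^sup>2) \<le> C"
  then show "square_summable_on f A"
    unfolding square_summable_on_def
    by (intro nonneg_bdd_above_summable_on) (auto simp: bdd_above_def)
qed

lemma square_summable_on_subset: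
  assumes "square_summable_on f A" and "B \<subseteq> A"
  shows "square_summable_on f B"
  using assms unfolding square_summable_on_def by (rule summable_on_subset_banach)

lemma infsum_Cauchy_Schwarz:
  fixes g f :: "'a \<Rightarrow> complex"
  assumes g: "\<And>S. finite S \<Longrightarrow> S \<subseteq> B \<Longrightarrow> (\<Sum>v\<in>S. (cmod (g v))\<^sup>2) \<le> C"
    and f: "square_summable_on f B"
  shows "(\<lambda>v. g v * f v) summable_on B"
    and "(cmod (\<Sum>\<^sub>\<infinity>v\<in>B. g v * f v))\<^sup>2 \<le> C * (\<Sum>\<^sub>\<infinity>v\<in>B. (cmod (f v))\<^sup>2)"
proof -
  let ?I = "\<Sum>\<^sub>\<infinity>v\<in>B. (cmod (f v))\<^sup>2"
  have C: "0 \<le> C"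
    using g[of "{}"] by simp
  have I: "0 \<le> ?I"
    by (simp add: infsum_nonneg)
  have sums: "(\<Sum>v\<in>S. cmod (g v * f v)) \<le> sqrt (C * ?I)" if S: "finite S" "S \<subseteq> B" for S
  proof -
    have "(\<Sum>v\<in>S. cmod (g v * f v)) \<le> L2_set (\<lambda>v. cmod (g v)) S * L2_set (\<lambda>v. cmod (f v)) S"
      using L2_set_mult_ineq[of "\<lambda>v. cmod (g v)" "\<lambda>v. cmod (f v)" S] by (simp add: norm_mult)
    also have "\<dots> \<le> sqrt C * sqrt ?I"
    proof (rule mult_mono)
      show "L2_set (\<lambda>v. cmod (g v)) S \<le> sqrt C"
        using g[OF S] by (simp add: L2_set_def)
      show "L2_set (\<lambda>v. cmod (f v)) S \<le> sqrt ?I"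
        using f S unfolding L2_set_def square_summable_on_def
        by (intro real_sqrt_le_mono finite_sum_le_infsum) auto
    qed (use C in \<open>auto intro: L2_set_nonneg\<close>)
    finally show ?thesis
      by (simp add: real_sqrt_mult)
  qed
  have abs: "(\<lambda>v. cmod (g v * f v)) summable_on B"
    using sums by (intro nonneg_bdd_above_summable_on) (auto simp: bdd_above_def)
  then show "(\<lambda>v. g v * f v) summable_on B"
    by (rule abs_summable_summable)
  have "cmod (\<Sum>\<^sub>\<infinity>v\<in>B. g v * f v) \<le> (\<Sum>\<^sub>\<infinity>v\<in>B. cmod (g v * f v))"
    using abs by (rule norm_infsum_bound)
  also have "\<dots> \<le> sqrt (C * ?I)"
    using abs sums by (rule infsum_le_finite_sums)
  finally have "(cmod (\<Sum>\<^sub>\<infinity>v\<in>B. g v * f v))\<^sup>2 \<le> (sqrt (C * ?I))\<^sup>2"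
    by (rule power_mono) simp
  then show "(cmod (\<Sum>\<^sub>\<infinity>v\<in>B. g v * f v))\<^sup>2 \<le> C * ?I"
    using C I by simp
qed


section \<open>Boundedness in terms of the fibres\<close>

lemma join_fibre_subset: "join_fibre T b u w \<subseteq> pverts T"
  by (auto simp: join_fibre_def)

lemma join_fibre_disjoint:
  "w \<noteq> w' \<Longrightarrow> join_fibre T b u w \<inter> join_fibre T b u w' = {}"
  by (auto simp: join_fibre_def)

text \<open>
  On each fibre the Cauchy-Schwarz inequality gives \<open>\<bar>(W f)(w)\<bar>\<^sup>2 \<le> C \<Sum> \<bar>f v\<bar>\<^sup>2\<close>, summed over the fibre.
  Adding this up over \<open>w\<close> counts every \<open>\<bar>f v\<bar>\<^sup>2\<close> at most once, because the fibres are disjoint.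
\<close>

lemma wj_map_bound:
  assumes lam: "\<And>w S. w \<in> pverts T \<Longrightarrow> finite S \<Longrightarrow> S \<subseteq> join_fibre T b u w \<Longrightarrow>
      (\<Sum>v\<in>S. (cmod (lam (Some v)))\<^sup>2) \<le> C"
    and C: "0 \<le> C"
    and f: "f \<in> ell2 (pverts T)"
  shows "f \<in> wj_domain T b u lam"
    and "ell2_norm (pverts T) (wj_map T b u lam f) \<le> sqrt C * ell2_norm (pverts T) f"
proof -
  let ?V = "pverts T" and ?B = "join_fibre T b u" and ?A = "wj_map T b u lam f"
  let ?I = "\<lambda>X. \<Sum>\<^sub>\<infinity>v\<in>X. (cmod (f v))\<^sup>2"
  have fV: "square_summable_on f ?V"
    using f by (simp add: ell2_def)
  have fB: "square_summable_on f (?B w)" for w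
    using fV join_fibre_subset by (rule square_summable_on_subset)
  have fsum: "(\<lambda>v. (cmod (f v))\<^sup>2) summable_on X" if "X \<subseteq> ?V" for X
    using square_summable_on_subset[OF fV that] by (simp add: square_summable_on_def)
  have conv: "(\<lambda>v. lam (Some v) * f v) summable_on ?B w" if "w \<in> ?V" for w
    using infsum_Cauchy_Schwarz(1)[OF lam[OF that] fB] by simp
  have pointwise: "(cmod (?A w))\<^sup>2 \<le> C * ?I (?B w)" if "w \<in> ?V" for w
    using infsum_Cauchy_Schwarz(2)[OF lam[OF that] fB] that by (simp add: wj_map_def)
  have sums: "(\<Sum>w\<in>W. (cmod (?A w))\<^sup>2) \<le> C * ?I ?V" if W: "finite W" "W \<subseteq> ?V" for W
  proof -
    have "(\<Sum>w\<in>W. (cmod (?A w))\<^sup>2) \<le> (\<Sum>w\<in>W. C * ?I (?B w))"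
      using pointwise W by (intro sum_mono) auto
    also have "\<dots> = C * (\<Sum>w\<in>W. ?I (?B w))"
      by (simp add: sum_distrib_left)
    also have "(\<Sum>w\<in>W. ?I (?B w)) = ?I (\<Union>w\<in>W. ?B w)"
      using W(1) fsum[OF join_fibre_subset] join_fibre_disjoint by (rule sum_infsum)
    also have "C * \<dots> \<le> C * ?I ?V"
      using C join_fibre_subset[of T b u]
      by (intro mult_left_mono infsum_mono2 fsum) auto
    finally show ?thesis .
  qed
  have Asum: "square_summable_on ?A ?V"
    unfolding square_summable_on_iff_bounded_sums using sums by blast
  then have "?A \<in> ell2 ?V"
    by (simp add: ell2_def wj_map_def)
  then show "f \<in> wj_domain T b u lam"
    using f conv by (simp add: wj_domain_def)
  have "(\<Sum>\<^sub>\<infinity>w\<in>?V. (cmod (?A w))\<^sup>2) \<le> C * ?I ?V"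
    using Asum sums unfolding square_summable_on_def by (rule infsum_le_finite_sums)
  then have "sqrt (\<Sum>\<^sub>\<infinity>w\<in>?V. (cmod (?A w))\<^sup>2) \<le> sqrt (C * ?I ?V)"
    by (rule real_sqrt_le_mono)
  then show "ell2_norm ?V ?A \<le> sqrt C * ell2_norm ?V f"
    unfolding ell2_norm_def by (simp only: real_sqrt_mult)
qed

lemma wj_map_add:
  assumes "f \<in> wj_domain T b u lam" and "g \<in> wj_domain T b u lam"
  shows "wj_map T b u lam (\<lambda>v. f v + g v) = (\<lambda>w. wj_map T b u lam f w + wj_map T b u lam g w)"
  using assms by (auto simp: wj_map_def wj_domain_def fun_eq_iff distrib_left intro!: infsum_add)

lemma wj_map_scale:
  "wj_map T b u lam (\<lambda>v. c * f v) = (\<lambda>w. c * wj_map T b u lam f w)"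
proof -
  have "(\<Sum>\<^sub>\<infinity>v\<in>B. lam (Some v) * (c * f v)) = c * (\<Sum>\<^sub>\<infinity>v\<in>B. lam (Some v) * f v)" for B
    by (simp add: mult.left_commute infsum_cmult_right')
  then show ?thesis
    by (auto simp: wj_map_def)
qed

text \<open>
  Let \<open>s\<close> be the sum of \<open>\<bar>\<lambda>\<^sub>u\<^sub>v\<bar>\<^sup>2\<close> over a finite piece of a fibre. The conjugated weights on this piece
  form a vector of norm \<open>\<surd>s\<close>, whose image has \<open>s\<close> at the base of the fibre as its only entry. An
  operator of norm at most \<open>C\<close> thus forces \<open>s \<le> C \<surd>s\<close>, that is, \<open>s \<le> C\<^sup>2\<close>.
\<close>

lemma fibre_sums_bounded:
  assumes "bounded_operator_on_ell2 (pverts T) (wj_domain T b u lam) (wj_map T b u lam)"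
  obtains C where "\<And>w S. w \<in> pverts T \<Longrightarrow> finite S \<Longrightarrow> S \<subseteq> join_fibre T b u w \<Longrightarrow>
      (\<Sum>v\<in>S. (cmod (lam (Some v)))\<^sup>2) \<le> C"
proof -
  let ?V = "pverts T" and ?B = "join_fibre T b u" and ?A = "wj_map T b u lam"
  obtain C where dom: "wj_domain T b u lam = ell2 ?V"
    and C: "\<And>f. f \<in> ell2 ?V \<Longrightarrow> ell2_norm ?V (?A f) \<le> C * ell2_norm ?V f"
    using assms unfolding bounded_operator_on_ell2_def by metis
  have "(\<Sum>v\<in>S. (cmod (lam (Some v)))\<^sup>2) \<le> C\<^sup>2"
    if w: "w \<in> ?V" and S: "finite S" "S \<subseteq> ?B w" for w S
  proof -
    define s where "s = (\<Sum>v\<in>S. (cmod (lam (Some v)))\<^sup>2)"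
    define f where "f v = (if v \<in> S then cnj (lam (Some v)) else 0)" for v
    have s0: "0 \<le> s"
      unfolding s_def by (simp add: sum_nonneg)
    have SV: "S \<subseteq> ?V"
      using S(2) join_fibre_subset by (rule subset_trans)
    have f_sum: "(\<Sum>\<^sub>\<infinity>v\<in>?V. (cmod (f v))\<^sup>2) = s"
    proof -
      have "(\<Sum>\<^sub>\<infinity>v\<in>?V. (cmod (f v))\<^sup>2) = (\<Sum>\<^sub>\<infinity>v\<in>S. (cmod (lam (Some v)))\<^sup>2)"
        using SV by (intro infsum_cong_neutral) (auto simp: f_def)
      then show ?thesis
        using S(1) by (simp add: s_def)
    qed
    have "(\<lambda>v. (cmod (f v))\<^sup>2) summable_on ?V \<longleftrightarrow> (\<lambda>v. (cmod (f v))\<^sup>2) summable_on S"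
      using SV by (intro summable_on_cong_neutral) (auto simp: f_def)
    then have f_ell2: "f \<in> ell2 ?V"
      using S(1) SV by (auto simp: ell2_def square_summable_on_def f_def)
    have Af: "?A f w' = (if w' = w then complex_of_real s else 0)" for w'
    proof (cases "w' = w")
      case True
      have "(\<Sum>\<^sub>\<infinity>v\<in>?B w. lam (Some v) * f v) = (\<Sum>\<^sub>\<infinity>v\<in>S. lam (Some v) * cnj (lam (Some v)))"
        using S(2) by (intro infsum_cong_neutral) (auto simp: f_def)
      also have "\<dots> = complex_of_real s"
        using S(1) by (simp add: s_def complex_norm_square del: of_real_power)
      finally show ?thesis
        using True w by (simp add: wj_map_def)
    next
      case False
      have "(\<Sum>\<^sub>\<infinity>v\<in>?B w'. lam (Some v) * f v) = (\<Sum>\<^sub>\<infinity>v\<in>?B w'. 0)"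
        using S(2) join_fibre_disjoint[OF False, of T b u]
        by (intro infsum_cong) (auto simp: f_def)
      then show ?thesis
        using False by (simp add: wj_map_def)
    qed
    have "(\<Sum>\<^sub>\<infinity>w'\<in>?V. (cmod (?A f w'))\<^sup>2) = (\<Sum>\<^sub>\<infinity>w'\<in>{w}. s\<^sup>2)"
      using w by (intro infsum_cong_neutral) (auto simp: Af)
    then have "ell2_norm ?V (?A f) = s"
      using s0 by (simp add: ell2_norm_def)
    then have "s \<le> C * sqrt s"
      using C[OF f_ell2] f_sum by (simp add: ell2_norm_def)
    then have "s * s \<le> C * sqrt s * (C * sqrt s)"
      using s0 by (intro mult_mono) auto
    then have "s * s \<le> C\<^sup>2 * s"
      using s0 by (simp add: power2_eq_square algebra_simps)
    then show ?thesis
      using s0 unfolding s_def[symmetric] by (cases "s = 0") auto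
  qed
  then show ?thesis
    using that by blast
qed

lemma wj_bounded_iff_fibre_sums_bounded:
  "bounded_operator_on_ell2 (pverts T) (wj_domain T b u lam) (wj_map T b u lam) \<longleftrightarrow>
    (\<exists>C. \<forall>w\<in>pverts T. \<forall>S. finite S \<and> S \<subseteq> join_fibre T b u w \<longrightarrow>
      (\<Sum>v\<in>S. (cmod (lam (Some v)))\<^sup>2) \<le> C)" (is "?bounded \<longleftrightarrow> ?sums")
proof
  assume ?bounded
  then show ?sums
    by (rule fibre_sums_bounded) blast
next
  assume ?sums
  then obtain C where C: "\<And>w S. w \<in> pverts T \<Longrightarrow> finite S \<Longrightarrow> S \<subseteq> join_fibre T b u w \<Longrightarrow>
      (\<Sum>v\<in>S. (cmod (lam (Some v)))\<^sup>2) \<le> C"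
    by blast
  (* On an empty vertex set the hypothesis says nothing about the sign of C. *)
  have "(\<Sum>v\<in>S. (cmod (lam (Some v)))\<^sup>2) \<le> max 0 C"
    if "w \<in> pverts T" "finite S" "S \<subseteq> join_fibre T b u w" for w S
    using C[OF that] by simp
  then have bound: "f \<in> wj_domain T b u lam"
      "ell2_norm (pverts T) (wj_map T b u lam f) \<le> sqrt (max 0 C) * ell2_norm (pverts T) f"
    if "f \<in> ell2 (pverts T)" for f
    using wj_map_bound[of T b u lam "max 0 C" f] that by simp_all
  have dom: "wj_domain T b u lam = ell2 (pverts T)"
    using bound(1) by (auto simp: wj_domain_def)
  have "\<exists>C. \<forall>f\<in>ell2 (pverts T).
      ell2_norm (pverts T) (wj_map T b u lam f) \<le> C * ell2_norm (pverts T) f"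
    using bound(2) by (intro exI[of _ "sqrt (max 0 C)"]) auto
  moreover have "wj_map T b u lam f \<in> ell2 (pverts T)" if "f \<in> ell2 (pverts T)" for f
    using that dom by (auto simp: wj_domain_def)
  ultimately show ?bounded
    unfolding bounded_operator_on_ell2_def
    by (simp add: wj_map_scale wj_map_add dom)
qed


section \<open>Ancestors\<close>

definition ancestors_or_self :: "'a pair_pre_digraph \<Rightarrow> 'a \<Rightarrow> 'a set" where
  "ancestors_or_self T v = {w. \<exists>n. par_pow T n v = Some w}"

lemma par_pow_add: "par_pow T (m + n) v = Option.bind (par_pow T n v) (par_pow T m)"
  by (induction m) (auto split: bind_splits)

lemma par_pow_Suc_parent: "par T v = Some p \<Longrightarrow> par_pow T (Suc n) v = par_pow T n p"
  using par_pow_add[of T n 1 v] by simp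

lemma Asc_subset_ancestors_or_self: "Asc T v \<subseteq> ancestors_or_self T v"
  by (auto simp: Asc_def ancestors_or_self_def)

context rooted_directed_tree
begin

lemma par_eq_Some_iff: "par T v = Some p \<longleftrightarrow> (p, v) \<in> parcs T"
proof -
  have "\<exists>!q. (q, v) \<in> parcs T" if "(p, v) \<in> parcs T" for p
    using that unique_parent[of v] arc_snd_in_verts[OF that] by (auto simp: is_root_def)
  then show ?thesis
    by (auto simp: par_def the1_equality intro: theI')
qed

lemma par_pow_in_verts: "v \<in> pverts T \<Longrightarrow> par_pow T n v = Some w \<Longrightarrow> w \<in> pverts T"
  by (induction n arbitrary: w)
    (auto simp: bind_eq_Some_conv par_eq_Some_iff dest: arc_fst_in_verts)

lemma ancestors_or_self_subset: "v \<in> pverts T \<Longrightarrow> ancestors_or_self T v \<subseteq> pverts T"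
  by (auto simp: ancestors_or_self_def par_pow_in_verts)

text \<open>
  Walk from the root to \<open>v\<close> along arcs of either orientation and keep track of the property that
  iterated parents lead to the root. A step down an arc adds one iterate. A step up an arc goes to the
  parent, which is unique, so it removes one iterate.
\<close>

lemma par_pow_reaches_root:
  assumes r: "is_root T r" and v: "v \<in> pverts T"
  shows "\<exists>n. par_pow T n v = Some r"
proof -
  have "(r, v) \<in> rtrancl_on (pverts T) (parcs (mk_symmetric (with_proj T)))"
    using tree r v
    by (auto simp: tree_def connected_def strongly_connected_def reachable_def is_root_def)
  then show ?thesis
  proof (induction rule: rtrancl_on_induct)
    case base
    show ?case
      by (rule exI[of _ 0]) simp
  next
    case (step x y)
    obtain n where n: "par_pow T n x = Some r"
      using step.IH by blast
    consider (down) "(x, y) \<in> parcs T" | (up) "(y, x) \<in> parcs T"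
      using step.hyps by (auto simp: parcs_mk_symmetric)
    then show ?case
    proof cases
      case down
      then have "par_pow T (Suc n) y = Some r"
        using n par_pow_Suc_parent par_eq_Some_iff by metis
      then show ?thesis ..
    next
      case up
      then have "x \<noteq> r"
        using r by (auto simp: is_root_def)
      then obtain m where "n = Suc m"
        using n by (cases n) auto
      then have "par_pow T m y = Some r"
        using n up par_pow_Suc_parent par_eq_Some_iff by metis
      then show ?thesis ..
    qed
  qed
qed

text \<open>
  The chain of parents of \<open>v\<close> ends at the root. This gives both finiteness of the set of ancestors
  and \<open>v \<notin> Asc T v\<close>, as a vertex that is its own ancestor would have an unending chain.
\<close>

lemma par_pow_eventually_None:
  assumes "v \<in> pverts T"
  obtains N where "\<And>n. n \<ge> N \<Longrightarrow> par_pow T n v = None"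
proof -
  obtain r where r: "is_root T r"
    using unique_root by blast
  obtain n where n: "par_pow T n v = Some r"
    using par_pow_reaches_root[OF r assms] by blast
  have "par T r = None"
    using r par_eq_Some_iff by (auto simp: is_root_def intro: ccontr)
  then have "par_pow T (Suc n) v = None"
    using n by simp
  then have "par_pow T m v = None" if "m \<ge> Suc n" for m
    using that par_pow_add[of T "m - Suc n" "Suc n" v] by simp
  then show ?thesis
    using that by blast
qed

lemma finite_ancestors_or_self:
  assumes "v \<in> pverts T"
  shows "finite (ancestors_or_self T v)"
proof -
  obtain N where N: "\<And>n. n \<ge> N \<Longrightarrow> par_pow T n v = None"
    using par_pow_eventually_None[OF assms] by blast
  have "n < N" if "par_pow T n v = Some w" for n w
    using that N[of n] by (cases "n < N") auto
  then have "ancestors_or_self T v \<subseteq> (\<lambda>n. the (par_pow T n v)) ` {..<N}"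
    by (force simp: ancestors_or_self_def)
  then show ?thesis
    by (rule finite_subset) simp
qed

lemma not_in_Asc_self:
  assumes "v \<in> pverts T"
  shows "v \<notin> Asc T v"
proof
  assume "v \<in> Asc T v"
  then obtain n where n: "n \<ge> 1" "par_pow T n v = Some v"
    by (auto simp: Asc_def)
  have loop: "par_pow T (k * n) v = Some v" for k
    by (induction k) (auto simp: par_pow_add n(2))
  obtain N where "\<And>n. n \<ge> N \<Longrightarrow> par_pow T n v = None"
    using par_pow_eventually_None[OF assms] by blast
  then show False
    using loop[of N] n(1) by simp
qed

lemma Des_imp_ancestor:
  assumes "v \<in> Des T u"
  shows "u \<in> ancestors_or_self T v"
proof -
  have "(u, v) \<in> rtrancl_on (pverts T) (parcs T)"
    using assms by (simp add: Des_def reachable_def)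
  then show ?thesis
  proof (induction rule: rtrancl_on_induct)
    case base
    show ?case
      by (auto simp: ancestors_or_self_def intro: exI[of _ 0])
  next
    case (step x y)
    then obtain n where "par_pow T n x = Some u"
      by (auto simp: ancestors_or_self_def)
    moreover have "par T y = Some x"
      using step.hyps by (simp add: par_eq_Some_iff)
    ultimately have "par_pow T (Suc n) y = Some u"
      by (metis par_pow_Suc_parent)
    then show ?case
      unfolding ancestors_or_self_def by blast
  qed
qed

lemma Des_subset: "Des T u \<subseteq> pverts T"
  by (auto simp: Des_def reachable_def dest: in_rtrancl_on_in_F)


section \<open>Values of the join\<close>

lemma Des_extended_tree: "Some v \<in> Des (extended_tree T) (Some u) \<longleftrightarrow> v \<in> Des T u"
proof
  let ?E = "extended_tree T"
  assume "Some v \<in> Des ?E (Some u)"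
  then have "(Some u, Some v) \<in> rtrancl_on (pverts ?E) (parcs ?E)"
    by (simp add: Des_def reachable_def)
  then have "\<forall>y. Some v = Some y \<longrightarrow> (u, y) \<in> rtrancl_on (pverts T) (parcs T)"
  proof (induction rule: rtrancl_on_induct)
    case base
    then show ?case
      by (auto simp: extended_tree_def)
  next
    case (step x z)
    then show ?case
      by (auto simp: extended_tree_def intro: rtrancl_on_into_rtrancl_on)
  qed
  then show "v \<in> Des T u"
    by (simp add: Des_def reachable_def)
next
  let ?E = "extended_tree T"
  assume "v \<in> Des T u"
  then have "(u, v) \<in> rtrancl_on (pverts T) (parcs T)"
    by (simp add: Des_def reachable_def)
  then have "(Some u, Some v) \<in> rtrancl_on (pverts ?E) (parcs ?E)"
  proof (induction rule: rtrancl_on_induct)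
    case base
    then show ?case
      by (auto simp: extended_tree_def)
  next
    case (step x z)
    then show ?case
      by (intro rtrancl_on_into_rtrancl_on[OF step.IH]) (auto simp: extended_tree_def)
  qed
  then show "Some v \<in> Des ?E (Some u)"
    by (simp add: Des_def reachable_def)
qed

text \<open>
  The root is a common ancestor, and \<open>u\<close> has finitely many ancestors, so a common ancestor of largest
  depth exists.
\<close>

lemma meet_in_ancestors:
  assumes u: "u \<in> pverts T" and v: "v \<in> pverts T"
  shows "\<exists>w\<in>ancestors_or_self T u. meet T (Some u) (Some v) = Some w"
proof -
  let ?common = "\<lambda>w. w \<in> pverts T \<and> (\<exists>n m. par_pow T n u = Some w \<and> par_pow T m v = Some w)"
  obtain r where r: "is_root T r"
    using unique_root by blast
  have "?common r"
    using r par_pow_reaches_root[OF r u] par_pow_reaches_root[OF r v] by (auto simp: is_root_def)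
  moreover have "finite {w. ?common w}"
    by (rule finite_subset[OF _ finite_ancestors_or_self[OF u]]) (auto simp: ancestors_or_self_def)
  then have "\<forall>w. ?common w \<longrightarrow> depth T w < Suc (Max (depth T ` {w. ?common w}))"
    by (auto intro!: le_imp_less_Suc Max_ge)
  ultimately have "?common (arg_max (depth T) ?common)"
    by (rule arg_max_natI)
  then show ?thesis
    by (auto simp: ancestors_or_self_def)
qed

lemma join_at_infinity:
  assumes "u \<in> pverts T" and "v \<in> pverts T"
  shows "\<exists>w\<in>ancestors_or_self T u. join_at T None (Some u) (Some v) = Some w"
  using meet_in_ancestors[OF assms] assms by (simp add: join_at_def)

lemma join_at_self:
  assumes "u \<in> pverts T"
  shows "join_at T (Some u) (Some u) (Some v) = Some v"
  using not_in_Asc_self[OF assms] by (auto simp: join_at_def)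

text \<open>
  Every other clause of the definition requires that \<open>v\<close> is one of the excluded vertices: the meet
  requires \<open>v \<in> Asc c\<close>, the base point clause \<open>v = c\<close>, and the value \<open>u\<close> of the join \<open>u \<in> Des v\<close>.
\<close>

lemma join_at_generic:
  assumes "c \<noteq> u" and "v \<notin> ancestors_or_self T c" and "v \<notin> ancestors_or_self T u"
  shows "join_at T (Some c) (Some u) (Some v) = (if v \<in> Des T u then Some v else None)"
proof -
  have "v \<notin> Asc T c"
    using assms(2) Asc_subset_ancestors_or_self[of T c] by blast
  moreover have "v \<noteq> c"
    using assms(2) by (auto simp: ancestors_or_self_def dest: spec[of _ 0])
  moreover have "u \<notin> Des T v"
    using assms(3) Des_imp_ancestor by blast
  ultimately show ?thesis
    using assms(1) by (auto simp: join_at_def join_def Des_extended_tree)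
qed


section \<open>Boundedness for each position of the base point\<close>

lemma wj_bounded_at_infinity:
  assumes u: "u \<in> pverts T"
  shows "bounded_operator_on_ell2 (pverts T) (wj_domain T None u lam) (wj_map T None u lam) \<longleftrightarrow>
    square_summable_on (\<lambda>v. lam (Some v)) (pverts T)"
    (is "_ \<longleftrightarrow> ?ell2")
  unfolding wj_bounded_iff_fibre_sums_bounded
proof
  let ?P = "ancestors_or_self T u" and ?B = "join_fibre T None u"
  assume "\<exists>C. \<forall>w\<in>pverts T. \<forall>S. finite S \<and> S \<subseteq> ?B w \<longrightarrow> (\<Sum>v\<in>S. (cmod (lam (Some v)))\<^sup>2) \<le> C"
  then have "square_summable_on (\<lambda>v. lam (Some v)) (?B w)" if "w \<in> ?P" for w
    unfolding square_summable_on_iff_bounded_sums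
    using that ancestors_or_self_subset[OF u] by blast
  then have "square_summable_on (\<lambda>v. lam (Some v)) (\<Union>w\<in>?P. ?B w)"
    unfolding square_summable_on_def
    using finite_ancestors_or_self[OF u]
    by (intro summable_on_finite_union_disjoint join_fibre_disjoint)
  moreover have "pverts T \<subseteq> (\<Union>w\<in>?P. ?B w)"
    using join_at_infinity[OF u] by (auto simp: join_fibre_def)
  ultimately show ?ell2
    by (rule square_summable_on_subset)
next
  assume ?ell2
  then obtain C where "\<And>S. finite S \<Longrightarrow> S \<subseteq> pverts T \<Longrightarrow> (\<Sum>v\<in>S. (cmod (lam (Some v)))\<^sup>2) \<le> C"
    unfolding square_summable_on_iff_bounded_sums by blast
  then show "\<exists>C. \<forall>w\<in>pverts T. \<forall>S. finite S \<and> S \<subseteq> join_fibre T None u w \<longrightarrow>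
      (\<Sum>v\<in>S. (cmod (lam (Some v)))\<^sup>2) \<le> C"
    using join_fibre_subset[of T None u] by (meson subset_trans)
qed

text \<open>
  A fibre has at most one point \<open>v \<notin> F\<close>, and this point lies in \<open>D\<close>. Its weight sum is thus at most
  \<open>\<bar>\<lambda>\<^sub>u\<^sub>v\<bar>\<^sup>2\<close> plus the sum over \<open>F\<close>. Conversely each \<open>v \<in> D - F\<close> lies in the fibre over itself, so a
  bound for the fibres bounds its weight.
\<close>

lemma wj_bounded_at_almost_identity:
  fixes lam :: "'a option \<Rightarrow> complex"
  assumes F: "finite F" and D: "D \<subseteq> pverts T"
    and join: "\<And>v. v \<in> pverts T - F \<Longrightarrow>
      join_at T b (Some u) (Some v) = (if v \<in> D then Some v else None)"
  shows "bounded_operator_on_ell2 (pverts T) (wj_domain T b u lam) (wj_map T b u lam) \<longleftrightarrow>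
    bounded ((\<lambda>v. lam (Some v)) ` D)"
  unfolding wj_bounded_iff_fibre_sums_bounded
proof
  assume "\<exists>C. \<forall>w\<in>pverts T. \<forall>S. finite S \<and> S \<subseteq> join_fibre T b u w \<longrightarrow>
    (\<Sum>v\<in>S. (cmod (lam (Some v)))\<^sup>2) \<le> C"
  then obtain C where C: "\<And>w S. w \<in> pverts T \<Longrightarrow> finite S \<Longrightarrow> S \<subseteq> join_fibre T b u w \<Longrightarrow>
      (\<Sum>v\<in>S. (cmod (lam (Some v)))\<^sup>2) \<le> C"
    by blast
  have "cmod (lam (Some v)) \<le> sqrt C" if "v \<in> D - F" for v
    using that D join[of v] C[of v "{v}"] by (auto simp: join_fibre_def intro: real_le_rsqrt)
  then have "bounded ((\<lambda>v. lam (Some v)) ` (D - F))"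
    unfolding bounded_iff by blast
  moreover have "bounded ((\<lambda>v. lam (Some v)) ` F)"
    using F by (intro finite_imp_bounded) simp
  ultimately have "bounded ((\<lambda>v. lam (Some v)) ` (D - F) \<union> (\<lambda>v. lam (Some v)) ` F)"
    by simp
  then show "bounded ((\<lambda>v. lam (Some v)) ` D)"
    by (rule bounded_subset) auto
next
  assume "bounded ((\<lambda>v. lam (Some v)) ` D)"
  then obtain M where M: "\<And>v. v \<in> D \<Longrightarrow> cmod (lam (Some v)) \<le> M"
    unfolding bounded_iff by blast
  let ?m = "\<lambda>v. (cmod (lam (Some v)))\<^sup>2"
  have "sum ?m S \<le> sum ?m F + M\<^sup>2"
    if "w \<in> pverts T" and S: "finite S" "S \<subseteq> join_fibre T b u w" for w S
  proof -
    have sub: "S - F \<subseteq> {w} \<inter> D"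
      using S(2) join by (fastforce simp: join_fibre_def split: if_splits)
    have "sum ?m S = sum ?m (S \<inter> F) + sum ?m (S - F)"
      using S(1) by (rule sum.Int_Diff)
    also have "sum ?m (S \<inter> F) \<le> sum ?m F"
      using F by (intro sum_mono2) auto
    also have "sum ?m (S - F) \<le> sum ?m ({w} \<inter> D)"
      using sub by (intro sum_mono2) auto
    also have "sum ?m ({w} \<inter> D) \<le> M\<^sup>2"
      using M[of w] by (cases "w \<in> D") (auto intro: power_mono)
    finally show ?thesis
      by simp
  qed
  then show "\<exists>C. \<forall>w\<in>pverts T. \<forall>S. finite S \<and> S \<subseteq> join_fibre T b u w \<longrightarrow> sum ?m S \<le> C"
    by blast
qed

end

theorem theorem3p7:
  fixes T :: "'a pair_pre_digraph"
    and u :: 'a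
    and b :: "'a option"
    and lam :: "'a option \<Rightarrow> complex"
  assumes "rooted_directed_tree T"
    and "u \<in> pverts T"
    and "b \<in> pverts (extended_tree T)"
    and "weight_system lam"
  shows "bounded_operator_on_ell2 (pverts T) (wj_domain T b u lam) (wj_map T b u lam) \<longleftrightarrow>
    (if b = None then square_summable_on (\<lambda>v. lam (Some v)) (pverts T)
     else if b = Some u then bounded ((\<lambda>v. lam (Some v)) ` pverts T)
     else bounded ((\<lambda>v. lam (Some v)) ` Des T u))"
proof -
  interpret rooted_directed_tree T
    by fact
  consider "b = None" | "b = Some u" | c where "b = Some c" "c \<noteq> u"
    by (cases b) auto
  then show ?thesis
  proof cases
    case 1
    then show ?thesis
      using wj_bounded_at_infinity[OF assms(2)] by simp
  next
    case 2
    then show ?thesis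
      using wj_bounded_at_almost_identity[of "{}" "pverts T" b u lam] join_at_self[OF assms(2)]
      by simp
  next
    case 3
    have "c \<in> pverts T"
      using assms(3) 3 by (auto simp: extended_tree_def)
    then have "finite (ancestors_or_self T c \<union> ancestors_or_self T u)"
      using finite_ancestors_or_self assms(2) by simp
    from wj_bounded_at_almost_identity[OF this Des_subset, of b u u lam]
    show ?thesis
      using 3 join_at_generic by simp
  qed
qed

end
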